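(* For every positive integer $n$, $\operatorname{ord}_{s_{123,132}}(S_n) = 2\left\lfloor \frac{n-1}{2}\right\rfloor$.
   Context: $S_n$ is the set of permutations of $[n]=\{1,\dots,n\}$, written in one-line notation $\pi=\pi_1\pi_2\cdots\pi_n$. A sequence $a_1\cdots a_k$ of distinct integers contains the pattern $\tau\in S_k$... more precisely, a sequence of distinct integers contains a pattern $\tau\in S_m$ if it has a (not necessarily consecutive) subsequence whose entries are in the same relative order as $\tau$; otherwise it avoids $\tau$. The map $s_{123,132}:S_n\to S_n$ is defined as follows. The entries of $\pi$ are read from left to right and a single stack is used, initially empty, together with an output word, initially empty. At each step, if there is a remaining input entry $x$ and placing $x$ on top of the stack would produce a stack whose contents, read from top to bottom, avoid both patterns $123$ and $132$, then $x$ is pushed onto the stack (pushing has priority); otherwise the top entry of the stack is popped and appended to the output. When the input is exhausted, the remaining stack entries are popped one at a time from the top and appended to the output. The output is $s_{123,132}(\pi)$. A permutation $\pi$ is periodic under a map $f$ if $f^k(\pi)=\pi$ for some positive integer $k$. For a set $P$ of permutations, $\operatorname{ord}_{s_{123,132}}(P)$ is the smallest nonnegative integer $k$ such that every element of $s_{123,132}^k(P)$ is periodic under $s_{123,132}$. *)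

theory Defs
  imports "HOL-Library.Sublist" "HOL-Combinatorics.Multiset_Permutations"
begin

text \<open>Permutations of \<open>{1..n}\<close> in one-line notation are the lists in
  \<^term>\<open>permutations_of_set {1..n}\<close>, i.e. the distinct lists with set of entries \<open>{1..n}\<close>.\<close>

definition same_relative_order :: "nat list \<Rightarrow> nat list \<Rightarrow> bool" where
  "same_relative_order v w \<longleftrightarrow> length v = length w \<and>
     (\<forall>i < length v. \<forall>j < length v. v ! i < v ! j \<longleftrightarrow> w ! i < w ! j)"

definition contains_pattern :: "nat list \<Rightarrow> nat list \<Rightarrow> bool" where
  "contains_pattern w \<tau> \<longleftrightarrow> (\<exists>v. subseq v w \<and> same_relative_order v \<tau>)"

abbreviation avoids_pattern :: "nat list \<Rightarrow> nat list \<Rightarrow> bool" where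
  "avoids_pattern w \<tau> \<equiv> \<not> contains_pattern w \<tau>"

text \<open>The arguments after the two patterns are the remaining input and the current stack, whose
  head is its top entry; the value is the output produced from that state on. An entry is always
  pushed on an empty stack, since a one-element stack avoids every pattern of length at
  least 2.\<close>

fun stack_run :: "nat list \<Rightarrow> nat list \<Rightarrow> nat list \<Rightarrow> nat list \<Rightarrow> nat list" where
  "stack_run \<sigma> \<tau> [] st = st"
| "stack_run \<sigma> \<tau> (x # xs) [] = stack_run \<sigma> \<tau> xs [x]"
| "stack_run \<sigma> \<tau> (x # xs) (t # st) =
     (if avoids_pattern (x # t # st) \<sigma> \<and> avoids_pattern (x # t # st) \<tau>
      then stack_run \<sigma> \<tau> xs (x # t # st)
      else t # stack_run \<sigma> \<tau> (x # xs) st)"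

definition stack_map :: "nat list \<Rightarrow> nat list \<Rightarrow> nat list \<Rightarrow> nat list" where
  "stack_map \<sigma> \<tau> \<pi> = stack_run \<sigma> \<tau> \<pi> []"

definition periodic_under :: "('a \<Rightarrow> 'a) \<Rightarrow> 'a \<Rightarrow> bool" where
  "periodic_under f x \<longleftrightarrow> (\<exists>k>0. (f ^^ k) x = x)"

definition ord_under :: "('a \<Rightarrow> 'a) \<Rightarrow> 'a set \<Rightarrow> nat" where
  "ord_under f P = (LEAST k. \<forall>x \<in> (f ^^ k) ` P. periodic_under f x)"

end

theory Submission
  imports Defs
begin

text \<open>A stack avoids both patterns iff every entry has at most one larger entry below it, so an entry
  \<open>x\<close> pops the stack until at most one entry exceeds \<open>x\<close>. The first input entry \<open>a\<close> is never popped,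
  and an entry \<open>e < a\<close> is popped by the first smaller entry after it. Hence the distance of \<open>e\<close> from
  the right end after one step is explicit: it counts the input from that smaller entry on, the entry
  \<open>a\<close>, and the entries between \<open>e\<close> and \<open>a\<close> in the stack. Put \<open>m = (n - 1) div 2\<close>. For \<open>e \<le> m\<close> this
  yields that after \<open>t \<ge> e\<close> steps this distance is at most \<open>2e - 1\<close> and at least
  \<open>min (2(t - e)) (2e - 1)\<close>, so after \<open>2m\<close> steps it is \<open>2e - 1\<close> for all \<open>e \<le> m\<close>. On such permutations
  the map rotates the word of the entries exceeding \<open>m\<close>, so they are periodic, and every periodic
  permutation is of this form.

  For sharpness, let the input start with the largest \<open>m - 1\<close> values in decreasing order, followed
  by \<open>m, \<dots>, 1\<close>. The leading values are moved to the right one per step, so that \<open>m\<close> is the first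
  entry after \<open>m - 1\<close> steps. It is last after \<open>m\<close> steps and moves left by two places per step
  from then on, which puts it at distance \<open>2m - 2\<close> after \<open>2m - 1\<close> steps.\<close>

section \<open>Pattern avoidance as a counting condition on the stack\<close>

fun run :: "nat list \<Rightarrow> nat list \<Rightarrow> nat list" where
  "run [] st = st"
| "run (x # xs) [] = run xs [x]"
| "run (x # xs) (t # st) =
     (if length (filter ((<) x) (t # st)) \<le> 1 then run xs (x # t # st)
      else t # run (x # xs) st)"

lemma same_order_123: "same_relative_order v [1, 2, 3] \<longleftrightarrow> (\<exists>a b c. v = [a, b, c] \<and> a < b \<and> b < c)"
proof
  assume h: "same_relative_order v [1, 2, 3]"
  then have "length v = 3" by (simp add: same_relative_order_def)
  then obtain a b c where v: "v = [a, b, c]"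
    by (auto simp: length_Suc_conv numeral_3_eq_3)
  have "v ! 0 < v ! 1" "v ! 1 < v ! 2"
    using h[unfolded same_relative_order_def, THEN conjunct2, rule_format, of 0 1]
      h[unfolded same_relative_order_def, THEN conjunct2, rule_format, of 1 2] v by simp_all
  with v show "\<exists>a b c. v = [a, b, c] \<and> a < b \<and> b < c" by auto
next
  assume "\<exists>a b c. v = [a, b, c] \<and> a < b \<and> b < c"
  then show "same_relative_order v [1, 2, 3]"
    by (auto simp: same_relative_order_def less_Suc_eq nth_Cons')
qed

lemma same_order_132: "same_relative_order v [1, 3, 2] \<longleftrightarrow> (\<exists>a b c. v = [a, b, c] \<and> a < c \<and> c < b)"
proof
  assume h: "same_relative_order v [1, 3, 2]"
  then have "length v = 3" by (simp add: same_relative_order_def)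
  then obtain a b c where v: "v = [a, b, c]"
    by (auto simp: length_Suc_conv numeral_3_eq_3)
  have "v ! 0 < v ! 2" "v ! 2 < v ! 1"
    using h[unfolded same_relative_order_def, THEN conjunct2, rule_format, of 0 2]
      h[unfolded same_relative_order_def, THEN conjunct2, rule_format, of 2 1] v by simp_all
  with v show "\<exists>a b c. v = [a, b, c] \<and> a < c \<and> c < b" by auto
next
  assume "\<exists>a b c. v = [a, b, c] \<and> a < c \<and> c < b"
  then show "same_relative_order v [1, 3, 2]"
    by (auto simp: same_relative_order_def less_Suc_eq nth_Cons')
qed

abbreviation (input) good :: "nat list \<Rightarrow> bool" where
  "good w \<equiv> avoids_pattern w [1, 2, 3] \<and> avoids_pattern w [1, 3, 2]"

text \<open>The two patterns cover both strict orders of two larger entries below a top entry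
  \<open>a\<close>. Entries may repeat, so \<open>b = c\<close> is the case left over.\<close>

lemma good_iff:
  "good w \<longleftrightarrow> (\<forall>a b c. subseq [a, b, c] w \<longrightarrow> a < b \<longrightarrow> a < c \<longrightarrow> b = c)"
proof -
  have 1: "contains_pattern w [1, 2, 3] \<longleftrightarrow> (\<exists>a b c. subseq [a, b, c] w \<and> a < b \<and> b < c)"
    unfolding contains_pattern_def same_order_123 by blast
  have 2: "contains_pattern w [1, 3, 2] \<longleftrightarrow> (\<exists>a b c. subseq [a, b, c] w \<and> a < c \<and> c < b)"
    unfolding contains_pattern_def same_order_132 by blast
  show ?thesis
    unfolding 1 2
  proof (intro iffI allI impI conjI notI; (elim exE conjE)?)
    fix a b c
    assume "\<nexists>a b c. subseq [a, b, c] w \<and> a < b \<and> b < c"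
      "\<nexists>a b c. subseq [a, b, c] w \<and> a < c \<and> c < b" "subseq [a, b, c] w" "a < b" "a < c"
    then have "\<not> b < c" "\<not> c < b" by blast+
    then show "b = c" by simp
  next
    fix a b c
    assume h: "\<forall>a b c. subseq [a, b, c] w \<longrightarrow> a < b \<longrightarrow> a < c \<longrightarrow> b = c" and s: "subseq [a, b, c] w"
    show False if "a < b" "b < c" using h[rule_format, OF s] that by simp
    show False if "a < c" "c < b" using h[rule_format, OF s] that by simp
  qed
qed

text \<open>Only triples starting with the new entry \<open>x\<close> can be new occurrences.
  Distinctness of \<open>S\<close> turns two surviving positions of the filter into two different
  values.\<close>

lemma good_Cons:
  assumes "good S" "distinct S"
  shows "good (x # S) \<longleftrightarrow> length (filter ((<) x) S) \<le> 1"
proof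
  assume g: "good (x # S)"
  show "length (filter ((<) x) S) \<le> 1"
  proof (rule ccontr)
    assume "\<not> ?thesis"
    then have "Suc (Suc 0) \<le> length (filter ((<) x) S)" by simp
    then obtain b c r where f: "filter ((<) x) S = b # c # r"
      unfolding Suc_le_length_iff by blast
    have "subseq [b, c] (filter ((<) x) S)" unfolding f by simp
    then have "subseq [b, c] S" by (rule subseq_order.order_trans) simp
    then have "subseq [x, b, c] (x # S)" by simp
    moreover have "b \<in> set (filter ((<) x) S)" "c \<in> set (filter ((<) x) S)" unfolding f by auto
    then have "x < b" "x < c" by auto
    moreover have "b \<noteq> c" using distinct_filter[OF assms(2), of "(<) x"] unfolding f by auto
    ultimately show False using g unfolding good_iff by blast
  qed
next
  assume l: "length (filter ((<) x) S) \<le> 1"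
  show "good (x # S)" unfolding good_iff
  proof (intro allI impI)
    fix a b c assume s: "subseq [a, b, c] (x # S)" and lt: "a < b" "a < c"
    show "b = c"
    proof (cases "subseq [a, b, c] S")
      case True
      then show ?thesis using assms(1) lt unfolding good_iff by blast
    next
      case False
      then have ax: "a = x" and sb: "subseq [b, c] S"
        using s by (auto simp: subseq_Cons2_iff split: if_splits)
      from sb have "subseq (filter ((<) x) [b, c]) (filter ((<) x) S)"
        by (rule subseq_filter)
      then have "subseq [b, c] (filter ((<) x) S)" using ax lt by simp
      then have "2 \<le> length (filter ((<) x) S)"
        using list_emb_length by fastforce
      with l show ?thesis by simp
    qed
  qed
qed

text \<open>The test in \<open>run\<close> looks at the new entry only, so \<open>good st\<close> is
  carried as an invariant: the test restores it after a push, and a pop passes to a sublist.\<close>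

lemma stack_run_eq_run:
  assumes "distinct (xs @ st)" "good st"
  shows "stack_run [1, 2, 3] [1, 3, 2] xs st = run xs st"
  using assms
proof (induction xs st rule: run.induct)
  case (2 x xs)
  have "good [x]" unfolding good_iff by simp
  with 2 show ?case by auto
next
  case (3 x xs t st)
  have d: "distinct (t # st)" using 3(3) by auto
  have g: "good st" using 3(4) unfolding good_iff by (meson list_emb_Cons)
  show ?case
  proof (cases "length (filter ((<) x) (t # st)) \<le> 1")
    case True
    then have "good (x # t # st)" using good_Cons[OF 3(4) d] by blast
    moreover from this have "stack_run [1, 2, 3] [1, 3, 2] xs (x # t # st) = run xs (x # t # st)"
      using 3(1)[OF True] 3(3) by simp
    ultimately show ?thesis
      unfolding stack_run.simps run.simps by (simp only: True if_True not_False_eq_True simp_thms)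
  next
    case False
    then have "\<not> good (x # t # st)" using good_Cons[OF 3(4) d] by blast
    moreover have "stack_run [1, 2, 3] [1, 3, 2] (x # xs) st = run (x # xs) st"
      using 3(2)[OF False] 3(3) g by simp
    ultimately show ?thesis
      unfolding stack_run.simps run.simps by (simp only: False if_False)
  qed
qed simp

definition srt :: "nat list \<Rightarrow> nat list" where
  "srt p = run p []"

lemma stack_map_eq_srt: "distinct p \<Longrightarrow> stack_map [1, 2, 3] [1, 3, 2] p = srt p"
  unfolding stack_map_def srt_def
  by (rule stack_run_eq_run) (simp, simp add: good_iff del: One_nat_def)

lemma srt_Cons: "srt (a # p) = run p [a]"
  by (simp add: srt_def)

section \<open>Conservation of entries, forced pops and protected stack bottoms\<close>

lemma mset_run [simp]: "mset (run xs st) = mset xs + mset st"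
  by (induction xs st rule: run.induct) auto

lemma length_run [simp]: "length (run xs st) = length xs + length st"
  by (metis mset_run size_mset size_union)

lemma mset_srt [simp]: "mset (srt p) = mset p"
  by (simp add: srt_def)

lemma set_srt [simp]: "set (srt p) = set p"
  by (metis mset_srt set_mset_mset)

lemma distinct_srt [simp]: "distinct (srt p) = distinct p"
  by (metis mset_srt mset_eq_imp_distinct_iff)

lemma run_push:
  assumes "length (filter ((<) x) st) \<le> 1"
  shows "run (x # xs) st = run xs (x # st)"
  using assms by (cases st) auto

text \<open>Each entry of \<open>A\<close>, while on top, exceeds \<open>x\<close> together with
  some entry of \<open>B\<close>; two larger entries force a pop.\<close>

lemma run_pop_above:
  assumes "\<forall>y\<in>set A. x < y" "\<exists>y\<in>set B. x < y"
  shows "run (x # w) (A @ B) = A @ run (x # w) B"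
  using assms(1)
proof (induction A)
  case (Cons y A)
  have "filter ((<) x) B \<noteq> []" using assms(2) by (auto simp: filter_empty_conv)
  then have "\<not> length (filter ((<) x) (y # A @ B)) \<le> 1" using Cons.prems
    by (cases "filter ((<) x) B") auto
  with Cons show ?case by (simp del: filter.simps)
qed simp

text \<open>Every entry of \<open>U\<close> may be pushed directly onto \<open>B\<close>, so popping
  never reaches into \<open>B\<close>. The words \<open>V\<close> and \<open>A'\<close> are chosen
  before \<open>w\<close>, which lets later input be analysed separately.\<close>

lemma run_protected:
  assumes "\<forall>x\<in>set U. length (filter ((<) x) B) \<le> 1"
  shows "\<exists>V A'. (\<forall>w. run (U @ w) (A @ B) = V @ run w (A' @ B))
           \<and> mset V + mset A' = mset A + mset U"
  using assms
\<comment> \<open>The measure counts the input \<open>U\<close> twice and \<open>A\<close> once: a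
  push moves one entry from \<open>U\<close> to \<open>A\<close>, a pop removes one from
  \<open>A\<close>, and both lower it.\<close>
proof (induction "length U + length (U @ A)" arbitrary: U A rule: less_induct)
  case less
  show ?case
  proof (cases U)
    case Nil
    then show ?thesis by (intro exI[of _ "[]"] exI[of _ A]) auto
  next
    case (Cons x U')
    show ?thesis
    proof (cases "length (filter ((<) x) (A @ B)) \<le> 1")
      case True
      obtain V A' where "\<forall>w. run (U' @ w) ((x # A) @ B) = V @ run w (A' @ B)"
        "mset V + mset A' = mset (x # A) + mset U'"
        using less(1)[of U' "x # A"] less(2) Cons by auto
      moreover have "run (U @ w) (A @ B) = run (U' @ w) ((x # A) @ B)" for w
        using run_push[OF True, of "U' @ w"] Cons by simp
      ultimately show ?thesis using Cons by (intro exI[of _ V] exI[of _ A']) auto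
    next
      case False
      then obtain y A0 where A: "A = y # A0" using less(2) Cons by (cases A) auto
      obtain V A' where "\<forall>w. run (U @ w) (A0 @ B) = V @ run w (A' @ B)"
        "mset V + mset A' = mset A0 + mset U"
        using less(1)[of U A0] less(2) A by auto
      moreover have "run (U @ w) (A @ B) = y # run (U @ w) (A0 @ B)" for w
        using False Cons A by (simp del: filter.simps)
      ultimately show ?thesis using A by (intro exI[of _ "y # V"] exI[of _ A']) auto
    qed
  qed
qed

text \<open>The bottom entry \<open>a\<close> already exceeds \<open>e\<close>, so \<open>e\<close>
  is pushed exactly when nothing else does.\<close>

lemma run_insert_small:
  assumes "e < a"
  shows "\<exists>D C. A = D @ C \<and> (\<forall>w. run (e # w) (A @ [a]) = D @ run w (e # C @ [a]))
           \<and> (\<forall>y\<in>set C. y \<le> e)"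
proof (induction A)
  case Nil
  show ?case by (auto simp: run_push)
next
  case (Cons y A)
  show ?case
  proof (cases "length (filter ((<) e) ((y # A) @ [a])) \<le> 1")
    case True
    then have "filter ((<) e) (y # A) = []" using assms by (simp split: if_splits)
    then have "\<forall>z\<in>set (y # A). z \<le> e" unfolding filter_empty_conv not_less .
    with run_push[OF True] show ?thesis
      by (intro exI[of _ "[]"] exI[of _ "y # A"]) auto
  next
    case False
    from Cons obtain D C where "A = D @ C"
      "\<forall>w. run (e # w) (A @ [a]) = D @ run w (e # C @ [a])" "\<forall>y\<in>set C. y \<le> e" by blast
    with False show ?thesis
      by (intro exI[of _ "y # D"] exI[of _ C]) (auto simp del: filter.simps)
  qed
qed

section \<open>Distance from the right end and its change in one step\<close>

text \<open>Counting from the right makes the limiting position \<open>2 * e - 1\<close> independent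
  of \<open>n\<close>.\<close>

definition rpos :: "nat list \<Rightarrow> nat \<Rightarrow> nat" where
  "rpos p e = length (takeWhile (\<lambda>x. x \<noteq> e) (rev p))"

lemma rpos_append:
  assumes "e \<notin> set w"
  shows "rpos (u @ e # w) e = length w"
proof -
  have "takeWhile (\<lambda>x. x \<noteq> e) (rev w) = rev w"
    using assms by (auto simp: takeWhile_eq_all_conv)
  then show ?thesis using assms by (simp add: rpos_def takeWhile_tail takeWhile_append)
qed

text \<open>\<open>C\<close> is the part of the stack between \<open>e\<close> and \<open>a\<close>
  when \<open>e\<close> is pushed. A smaller immediate predecessor of \<open>e\<close> is then still
  on top of the stack, which makes \<open>C\<close> nonempty.\<close>

lemma run_reaching:
  assumes "e < a" "distinct (a # u @ [e])"
  shows "\<exists>O' C. (\<forall>w. run (u @ e # w) [a] = O' @ run w (e # C @ [a]))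
           \<and> distinct C \<and> set C \<subseteq> {y \<in> set u. y < e} \<and> (u \<noteq> [] \<and> last u < e \<longrightarrow> C \<noteq> [])"
proof -
  have reach: "\<exists>O' C. (\<forall>w. run (u @ e # w) [a] = O' @ run w (e # C @ [a]))
           \<and> distinct C \<and> set C \<subseteq> {y \<in> set u. y < e}"
    if "e < a" "distinct (a # u @ [e])" for u e
  proof -
    obtain V A where 1: "\<forall>w. run (u @ w) ([] @ [a]) = V @ run w (A @ [a])"
      and m: "mset V + mset A = mset [] + mset u"
      using run_protected[of u "[a]" "[]"] by fastforce
    obtain D C where A: "A = D @ C"
      and 2: "\<forall>w. run (e # w) (A @ [a]) = D @ run w (e # C @ [a])" "\<forall>y\<in>set C. y \<le> e"
      using run_insert_small[OF \<open>e < a\<close>] by blast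
    have m': "mset (V @ D @ C) = mset u" using m A by simp
    then have "distinct (V @ D @ C)" "set (V @ D @ C) = set u"
      using that(2) mset_eq_imp_distinct_iff[OF m'] mset_eq_setD[OF m'] by simp_all
    then have "distinct C" "set C \<subseteq> {y \<in> set u. y < e}"
      using 2(2) that(2) by (auto simp: order_le_less)
    moreover have "run (u @ e # w) [a] = (V @ D) @ run w (e # C @ [a])" for w
      using 1 2(1) by (metis append_Nil append_assoc)
    ultimately show ?thesis by blast
  qed
  show ?thesis
  proof (cases "u \<noteq> [] \<and> last u < e")
    case True
    then obtain u' y where u: "u = u' @ [y]" "y < e" by (metis append_butlast_last_id)
    with assms obtain O' C where C: "\<forall>w. run (u' @ y # w) [a] = O' @ run w (y # C @ [a])"
       "distinct C" "set C \<subseteq> {z \<in> set u'. z < y}" using reach[of y u'] by auto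
    \<comment> \<open>Right after the push of \<open>y\<close>, only \<open>a\<close> exceeds
      \<open>y\<close>, hence only \<open>a\<close> exceeds \<open>e\<close>, and \<open>e\<close>
      goes on top without a pop.\<close>
    have "filter ((<) e) (y # C @ [a]) = [a]"
      using C(3) u(2) assms(1) by (auto simp: filter_empty_conv)
    then have "run (u @ e # w) [a] = O' @ run w (e # (y # C) @ [a])" for w
      using C(1) u run_push[of e "y # C @ [a]"] by simp
    moreover have "distinct (y # C)" using C by auto
    moreover have "set (y # C) \<subseteq> {z \<in> set u. z < e}" using C u by auto
    ultimately show ?thesis by blast
  next
    case False
    then show ?thesis using reach[OF assms] by blast
  qed
qed

text \<open>\<open>Y\<close> lists the stack entries strictly between \<open>e\<close> and \<open>a\<close>.\<close>

lemma rpos_srt: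
  assumes "e < a" "distinct (a # u @ e # w)"
  shows "\<exists>Y. rpos (srt (a # u @ e # w)) e = 1 + length Y + length (dropWhile ((<) e) w)
           \<and> distinct Y \<and> set Y \<subseteq> {y \<in> set u. y < e} \<and> (u \<noteq> [] \<and> last u < e \<longrightarrow> Y \<noteq> [])"
proof -
  obtain O' Y where Y: "\<forall>w. run (u @ e # w) [a] = O' @ run w (e # Y @ [a])" "distinct Y"
     "set Y \<subseteq> {y \<in> set u. y < e}" "u \<noteq> [] \<and> last u < e \<longrightarrow> Y \<noteq> []"
    using run_reaching[of e a u] assms by auto
  let ?B = "Y @ [a]"
  define U where "U = takeWhile ((<) e) w"
  define v where "v = dropWhile ((<) e) w"
  have w: "w = U @ v" by (simp add: U_def v_def)
  have U: "\<forall>x\<in>set U. e < x" unfolding U_def by (auto dest: set_takeWhileD)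
  \<comment> \<open>Entries of \<open>U\<close> exceed \<open>e\<close> and thus all of
    \<open>Y\<close>; only \<open>a\<close> can be larger, so they never pop
    \<open>e\<close>.\<close>
  have prot: "length (filter ((<) x) (e # ?B)) \<le> 1" if "x \<in> set U" for x
  proof -
    have "filter ((<) x) (e # Y) = []" using Y(3) U that by (auto simp: filter_empty_conv)
    then have "filter ((<) x) (e # ?B) = filter ((<) x) [a]"
      by (metis append_Cons append_Nil filter_append)
    then show ?thesis by simp
  qed
  obtain V A where VA: "\<forall>w. run (U @ w) ([] @ e # ?B) = V @ run w (A @ e # ?B)"
      "mset V + mset A = mset [] + mset U"
    using run_protected[of U "e # ?B" "[]"] prot by blast
  have "mset (V @ A) = mset U" using VA(2) by simp
  then have A: "set A \<subseteq> set U" by (metis mset_eq_setD set_append Un_upper2)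
  \<comment> \<open>Either the input ends and the stack empties, or the first entry of
    \<open>v\<close> is below \<open>e\<close> and pops it, so that all of \<open>v\<close> and
    \<open>?B\<close> comes out afterwards.\<close>
  have tail: "\<exists>O1 T. run v (A @ e # ?B) = O1 @ e # T \<and> length T = length v + length ?B"
  proof (cases v)
    case Nil
    then show ?thesis by (intro exI[of _ A] exI[of _ ?B]) auto
  next
    case (Cons x v')
    then have "\<not> e < x" unfolding v_def by (metis hd_dropWhile list.discI list.sel(1))
    moreover have "x \<noteq> e" using assms(2) w Cons by auto
    ultimately have xe: "x < e" by simp
    have "run v (A @ e # ?B) = (A @ [e]) @ run v ?B"
      unfolding Cons
      using run_pop_above[of "A @ [e]" x ?B v'] xe A U assms(1) by fastforce
    then show ?thesis by (intro exI[of _ A] exI[of _ "run v ?B"]) auto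
  qed
  then obtain O1 T where T: "run v (A @ e # ?B) = O1 @ e # T" "length T = length v + length ?B" by blast
  have q: "srt (a # u @ e # w) = (O' @ V @ O1) @ e # T"
    using Y(1) VA(1) T(1) w by (simp add: srt_Cons)
  have "distinct (srt (a # u @ e # w))" using assms(2) by (simp only: distinct_srt)
  then have "e \<notin> set T" unfolding q by auto
  then have "rpos (srt (a # u @ e # w)) e = length T" unfolding q by (rule rpos_append)
  then show ?thesis using T(2) Y unfolding v_def by (intro exI[of _ Y]) auto
qed

lemma rpos_less:
  assumes "y \<in> set B" "distinct (A @ B)"
  shows "rpos (A @ B) y < length B"
proof -
  obtain B1 B2 where B: "B = B1 @ y # B2" using assms(1) by (meson split_list)
  then have "rpos (A @ B) y = length B2"
    using rpos_append[of y B2 "A @ B1"] assms(2) by simp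
  then show ?thesis using B by simp
qed

lemma rpos_ge:
  assumes "y \<in> set A" "distinct (A @ B)"
  shows "length B \<le> rpos (A @ B) y"
proof -
  obtain A1 A2 where A: "A = A1 @ y # A2" using assms(1) by (meson split_list)
  then have "rpos (A @ B) y = length (A2 @ B)"
    using rpos_append[of y "A2 @ B" A1] assms(2) by auto
  then show ?thesis by simp
qed

text \<open>From the leftmost entry of \<open>u\<close> lying in \<open>Y\<close> onwards there is
  room for all of \<open>Y\<close>. A bound on positions of small entries thereby bounds
  \<open>length Y\<close>.\<close>

lemma rpos_ge_subset:
  assumes "distinct (u @ B)" "set Y \<subseteq> set u" "distinct Y" "Y \<noteq> []"
  shows "\<exists>y\<in>set Y. length Y + length B \<le> Suc (rpos (u @ B) y)"
proof -
  have "\<exists>y\<in>set u. y \<in> set Y" using assms(2,4) by (cases Y) auto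
  then obtain u1 y u2 where u: "u = u1 @ y # u2" "y \<in> set Y" "\<forall>z\<in>set u1. z \<notin> set Y"
    by (rule split_list_first_propE)
  then have "set Y \<subseteq> set (y # u2)" using assms(2) by auto
  then have "card (set Y) \<le> length (y # u2)"
    by (meson card_length card_mono finite_set order_trans)
  then have "length Y \<le> Suc (length u2)" using assms(3) by (simp add: distinct_card)
  moreover have "rpos (u @ B) y = length (u2 @ B)"
    using rpos_append[of y "u2 @ B" u1] assms(1) u(1) by auto
  ultimately show ?thesis using u(2) by (intro bexI[of _ y]) auto
qed

lemma srt_last: "\<exists>V. srt (a # p) = V @ [a]"
proof -
  obtain V A where "\<forall>w. run (p @ w) ([] @ [a]) = V @ run w (A @ [a])"
    using run_protected[of p "[a]" "[]"] by fastforce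
  from spec[OF this, of "[]"] show ?thesis by (simp add: srt_Cons)
qed

section \<open>Small entries converge to their final positions\<close>

text \<open>The guard \<open>e \<le> t\<close> makes stage 0 vacuous. A newly guarded value
  \<open>e = t\<close> has lower bound 0, and the bound rises by 2 per step until it is
  capped.\<close>

definition staged :: "nat \<Rightarrow> nat \<Rightarrow> nat list \<Rightarrow> bool" where
  "staged m t p \<longleftrightarrow> (\<forall>e. 1 \<le> e \<and> e \<le> t \<and> e \<le> m \<longrightarrow>
     min (2 * (t - e)) (2 * e - 1) \<le> rpos p e \<and> rpos p e \<le> 2 * e - 1)"

lemma stagedD:
  assumes "staged m t p" "1 \<le> e" "e \<le> t" "e \<le> m"
  shows "min (2 * (t - e)) (2 * e - 1) \<le> rpos p e" "rpos p e \<le> 2 * e - 1"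
  using assms unfolding staged_def by auto

text \<open>The formula of \<open>rpos_srt\<close> is evaluated according to the first smaller entry
  \<open>x\<close> after \<open>e\<close>, if any. The bounds for \<open>x\<close>, or for smaller
  entries left of \<open>e\<close>, then give those for \<open>e\<close>.\<close>

lemma staged_srt:
  assumes p: "distinct p" "set p = {1..n}" "2 * m < n" and st: "staged m t p"
  shows "staged m (Suc t) (srt p)"
  unfolding staged_def
proof (intro allI impI, elim conjE)
  fix e assume e: "1 \<le> e" "e \<le> Suc t" "e \<le> m"
  have len: "length p = n" using p distinct_card by fastforce
  obtain a p' where pa: "p = a # p'" using len p(3) by (cases p) auto
  have "rpos p a = length p'" using rpos_append[of a p' "[]"] p(1) pa by simp
  then have ra: "2 * m \<le> rpos p a" using len pa p(3) by simp
  have a1: "1 \<le> a" using p(2) pa by auto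
  \<comment> \<open>The first entry has distance at least \<open>2 * m\<close>, which exceeds the
    upper bound for any controlled value.\<close>
  have a_big: "\<not> (a \<le> t \<and> a \<le> m)" using stagedD(2)[OF st a1] ra a1 by fastforce
  show "min (2 * (Suc t - e)) (2 * e - 1) \<le> rpos (srt p) e \<and> rpos (srt p) e \<le> 2 * e - 1"
  proof (cases "a = e")
    case True
    then have "e = Suc t" using a_big e by auto
    moreover obtain V where "srt p = V @ e # []" using srt_last[of a p'] pa True by auto
    then have "rpos (srt p) e = 0" using rpos_append[of e "[]" V] by simp
    ultimately show ?thesis by simp
  next
    case False
    then have ea: "e < a" using a_big e by linarith
    have "e \<in> set p'" using p(2,3) e pa False by (metis One_nat_def atLeastAtMost_iff le_trans less_imp_le_nat
         mult_2 nat_le_iff_add set_ConsD)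
    then obtain u w where p': "p' = u @ e # w" by (meson split_list)
    have d: "distinct (a # u @ e # w)" using p(1) pa p' by simp
    note pe = pa[unfolded p']
    have re: "rpos p e = length w" using rpos_append[of e w "a # u"] d pe by simp
    obtain Y where Y: "rpos (srt p) e = 1 + length Y + length (dropWhile ((<) e) w)"
      "distinct Y" "set Y \<subseteq> {y \<in> set u. y < e}" "u \<noteq> [] \<and> last u < e \<longrightarrow> Y \<noteq> []"
      using rpos_srt[OF ea d] unfolding pe by blast
    have before: "y \<in> set (a # u)" if "1 \<le> y" "y < e" "y \<notin> set w" for y
    proof -
      have "y \<in> set p" using p(2,3) that e by auto
      then show ?thesis using that pe by auto
    qed
    \<comment> \<open>An entry \<open>y\<close> left of \<open>e\<close> at distance at most
      \<open>Suc (length w)\<close> is the immediate predecessor of \<open>e\<close>.\<close>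
    have neighbour: "Y \<noteq> []" if "y \<in> set (a # u)" "y < e" "rpos p y \<le> Suc (length w)" for y
    proof -
      have "y \<in> set u" using that ea by auto
      then obtain u1 u2 where u: "u = u1 @ y # u2" by (meson split_list)
      then have "rpos p y = length (u2 @ e # w)"
        using rpos_append[of y "u2 @ e # w" "a # u1"] d pe by simp
      then have "u2 = []" using that(3) by simp
      then show ?thesis using Y(4) u that(2) by simp
    qed
    \<comment> \<open>Some \<open>y\<close> in \<open>Y\<close> has distance at least
      \<open>length Y + length w\<close>, but at most
      \<open>2 * y - 1 \<le> 2 * e - 3\<close>.\<close>
    have upper: "rpos (srt p) e \<le> 2 * e - 1" if nonempty: "Y \<noteq> []"
    proof -
      have "set Y \<subseteq> set (a # u)" using Y(3) by auto
      moreover have "distinct ((a # u) @ e # w)" using d by simp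
      ultimately obtain y where y: "y \<in> set Y" "length Y + length (e # w) \<le> Suc (rpos p y)"
        using rpos_ge_subset[of "a # u" "e # w" Y] Y(2) nonempty unfolding pe append_Cons by blast
      have "y < e" "y \<in> set p" using y(1) Y(3) pe by auto
      then have "1 \<le> y" using p(2) by auto
      then have "rpos p y \<le> 2 * y - 1" using stagedD(2)[OF st] \<open>y < e\<close> e by simp
      moreover have "length (dropWhile ((<) e) w) \<le> length w" by (rule length_dropWhile_le)
      ultimately show ?thesis using Y(1) y(2) \<open>y < e\<close> \<open>1 \<le> y\<close> by simp
    qed
    show ?thesis
    proof (cases "dropWhile ((<) e) w")
      case Nil
      then have r': "rpos (srt p) e = 1 + length Y" using Y(1) by simp
      have w: "\<forall>y\<in>set w. e < y" using Nil by (simp add: dropWhile_eq_Nil_conv)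
      \<comment> \<open>If the bound is not immediate, 1 stands left of \<open>e\<close> at distance
        at most 1. Then \<open>e\<close> is last with 1 directly before it, \<open>t = e\<close>,
        and the nonempty \<open>Y\<close> supplies the required 2.\<close>
      have "min (2 * (Suc t - e)) (2 * e - 1) \<le> rpos (srt p) e"
      proof (cases "e = 1 \<or> e = Suc t")
        case True
        then show ?thesis using r' by auto
      next
        case False
        then have e2: "1 < e" "e \<le> t" using e by auto
        then have "rpos p 1 \<le> 1" using stagedD(2)[OF st, of 1] e by simp
        moreover have "1 \<notin> set w" using w e2(1) by auto
        then have one: "1 \<in> set (a # u)" using before[of 1] e2 by simp
        moreover have "length (e # w) \<le> rpos p 1"
          using rpos_ge[OF one, of "e # w"] d pe by simp
        ultimately have "length w = 0" by (unfold list.size) linarith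
        then have "w = []" by simp
        then have "rpos p e = 0" using re by simp
        then have "t \<le> e" using stagedD(1)[OF st, of e] e e2 by auto
        have "Y \<noteq> []" using neighbour[OF one e2(1)] \<open>rpos p 1 \<le> 1\<close> by simp
        then have "length Y \<ge> 1" by (simp add: Suc_le_eq)
        then show ?thesis using r' \<open>t \<le> e\<close> by auto
      qed
      moreover have "rpos (srt p) e \<le> 2 * e - 1" using upper r' e by (cases "Y = []") auto
      ultimately show ?thesis by blast
    next
      case (Cons x v)
      define U where "U = takeWhile ((<) e) w"
      have w: "w = U @ x # v" unfolding U_def using Cons by (metis takeWhile_dropWhile_id)
      have U: "\<forall>y\<in>set U. e < y" unfolding U_def by (auto dest: set_takeWhileD)
      have "\<not> e < x" using Cons by (metis hd_dropWhile list.discI list.sel(1))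
      moreover have "x \<noteq> e" using d w by auto
      ultimately have xe: "x < e" by simp
      have rx: "rpos p x = length v"
        using rpos_append[of x v "a # u @ e # U"] d pe w by simp
      have r': "rpos (srt p) e = 2 + length Y + rpos p x" using Y(1) Cons rx by simp
      have x1: "1 \<le> x" using p(2) pe w by auto
      have xt: "x \<le> t" "x \<le> m" using xe e by auto
      note bx = stagedD[OF st x1 xt]
      have lower: "min (2 * (Suc t - e)) (2 * e - 1) \<le> rpos (srt p) e"
      proof (cases "2 * (t - x) \<le> 2 * x - 1")
        case True
        then show ?thesis using bx(1) r' xe xt by auto
      next
        \<comment> \<open>Here \<open>x\<close> has reached \<open>2 * x - 1\<close>, so the new
          distance is at least \<open>2 * x + 1\<close>. This may miss the bound by one, and
          \<open>Suc x\<close> is used to close the gap.\<close>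
        case settled: False
        then have rx': "rpos p x = 2 * x - 1" using bx by simp
        show ?thesis
        proof (cases "e = Suc x \<or> t \<le> 2 * x + 1")
          case True
          then show ?thesis using r' rx' xe e x1 by auto
        next
          case False
          then have "Suc x < e" using xe by simp
          have "rpos p (Suc x) = 2 * x + 1"
            using stagedD[OF st, of "Suc x"] \<open>Suc x < e\<close> e False by auto
          \<comment> \<open>\<open>Suc x\<close> is below the entries of \<open>U\<close>, and its
            distance \<open>2 * x + 1\<close> is too large for \<open>v\<close>. Left of
            \<open>e\<close>, it must be the direct predecessor.\<close>
          moreover have "Suc x \<notin> set w"
          proof
            assume "Suc x \<in> set w"
            then have "Suc x \<in> set v" using w U \<open>Suc x < e\<close> by auto
            then have "rpos p (Suc x) < length v"
              using rpos_less[of "Suc x" v "a # u @ e # U @ [x]"] d pe w by simp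
            then show False using calculation rx rx' by simp
          qed
          then have sx: "Suc x \<in> set (a # u)" using before \<open>Suc x < e\<close> by simp
          moreover have "length (e # w) \<le> rpos p (Suc x)"
            using rpos_ge[OF sx, of "e # w"] d pe by simp
          moreover have "rpos p x < length w" using rx w by simp
          ultimately have "length w = 2 * x" using rx' by simp
          then have "Y \<noteq> []" using neighbour[OF sx \<open>Suc x < e\<close>] \<open>rpos p (Suc x) = 2 * x + 1\<close> by simp
          then have "length Y \<ge> 1" by (simp add: Suc_le_eq)
          then have "rpos (srt p) e \<ge> 2 * x + 2" using r' rx' x1 by simp
          \<comment> \<open>The old lower bound for \<open>e\<close>, now at distance
            \<open>2 * x\<close>, limits \<open>t - e\<close> to \<open>x\<close>.\<close>
          moreover have "Suc t - e \<le> Suc x"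
            using stagedD(1)[OF st, of e] e re \<open>length w = 2 * x\<close> \<open>Suc x < e\<close>
            by (cases "e \<le> t") auto
          ultimately show ?thesis by simp
        qed
      qed
      have "rpos (srt p) e \<le> 2 * e - 1"
        using upper r' bx(2) xe x1 by (cases "Y = []") auto
      with lower show ?thesis by blast
    qed
  qed
qed

lemma set_funpow_srt [simp]: "set ((srt ^^ t) p) = set p"
  by (induction t) auto

lemma distinct_funpow_srt [simp]: "distinct ((srt ^^ t) p) = distinct p"
  by (induction t) auto

lemma staged_funpow:
  assumes "distinct p" "set p = {1..n}" "2 * m < n"
  shows "staged m t ((srt ^^ t) p)"
proof (induction t)
  case 0
  show ?case by (simp add: staged_def)
next
  case (Suc t)
  then show ?case using staged_srt[of "(srt ^^ t) p" n m t] assms by simp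
qed

lemma rpos_settled:
  assumes "distinct p" "set p = {1..n}" "2 * m < n" "2 * m \<le> t" "1 \<le> e" "e \<le> m"
  shows "rpos ((srt ^^ t) p) e = 2 * e - 1"
  using stagedD[OF staged_funpow[OF assms(1-3), of t], of e] assms(4-6) by auto

section \<open>Settled permutations and rotation of their large entries\<close>

text \<open>With \<open>k = length ys\<close>, this is the word \<open>k, y\<^sub>1, k - 1, y\<^sub>2, \<dots>, 1, y\<^sub>k\<close>.\<close>

primrec zig :: "nat list \<Rightarrow> nat list" where
  "zig [] = []"
| "zig (y # ys) = Suc (length ys) # y # zig ys"

lemma length_zig [simp]: "length (zig ys) = 2 * length ys"
  by (induction ys) auto

lemma mset_zig: "mset (zig ys) = mset ys + mset [1..<Suc (length ys)]"
  by (induction ys) auto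

text \<open>The values up to \<open>m\<close> fill a suffix of length \<open>2 * m\<close> with
  their partners, so \<open>Suc m\<close> at distance \<open>2 * m + 1\<close> leaves room for
  exactly one further partner.\<close>

lemma settled_imp_zig:
  assumes "distinct p" "2 * m \<le> length p" "\<forall>e. 1 \<le> e \<and> e \<le> m \<longrightarrow> e \<in> set p \<and> rpos p e = 2 * e - 1"
  shows "\<exists>W ys. p = W @ zig ys \<and> length ys = m"
  using assms(2,3)
proof (induction m)
  case (Suc m)
  then obtain W ys where p: "p = W @ zig ys" and l: "length ys = m" by fastforce
  have r: "Suc m \<in> set p" "rpos p (Suc m) = 2 * m + 1" using Suc(3) by auto
  have "Suc m \<notin> set (zig ys)" using rpos_less[of "Suc m" "zig ys" W] assms(1) p l r(2) by auto
  then obtain W1 W2 where W: "W = W1 @ Suc m # W2" using r(1) p by (auto dest: split_list)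
  then have "rpos p (Suc m) = length (W2 @ zig ys)"
    using rpos_append[of "Suc m" "W2 @ zig ys" W1] assms(1) p by simp
  then have "length W2 = 1" using r(2) l by simp
  then obtain y where "W2 = [y]" by (auto simp: length_Suc_conv)
  then have "p = W1 @ zig (y # ys)" using p W l by simp
  with l show ?case by (intro exI[of _ W1] exI[of _ "y # ys"]) simp
qed simp

text \<open>The next small entry pops everything above \<open>a\<close>; its partner then lands on
  top of it, and the stack again has the form \<open>A @ [Suc (length ys), a]\<close> with a
  one-entry \<open>A\<close>.\<close>

lemma run_zig:
  assumes "\<forall>x\<in>set A. length ys < x" "\<forall>y\<in>set ys. length ys < y" "length ys < a"
  shows "run (zig ys) (A @ [Suc (length ys), a]) = A @ zig (ys @ [a])"
  using assms
proof (induction ys arbitrary: A)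
  case (Cons y ys)
  let ?k = "Suc (length ys)"
  have "run (zig (y # ys)) (A @ [Suc ?k, a]) = run (?k # y # zig ys) ((A @ [Suc ?k]) @ [a])" by simp
  also have "\<dots> = (A @ [Suc ?k]) @ run (?k # y # zig ys) [a]"
    using Cons.prems by (intro run_pop_above) auto
  also have "run (?k # y # zig ys) [a] = run (zig ys) ([y] @ [?k, a])"
    using Cons.prems(2) by (simp add: run_push)
  also have "\<dots> = [y] @ zig (ys @ [a])" using Cons.prems by (intro Cons.IH) auto
  finally show ?case by simp
qed simp

text \<open>The partners act as a queue: \<open>y\<close> leaves on the left, \<open>a\<close>
  enters on the right, and every other partner moves to the next larger small entry.\<close>

lemma run_zig_Cons:
  assumes "\<forall>x\<in>set A. length (y # ys) < x" "\<forall>x\<in>set (y # ys). length (y # ys) < x" "length (y # ys) < a"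
  shows "run (zig (y # ys)) (A @ [a]) = A @ y # zig (ys @ [a])"
proof -
  let ?k = "Suc (length ys)"
  have "run (?k # y # zig ys) (A @ [a]) = A @ run (?k # y # zig ys) [a]"
    using assms by (intro run_pop_above) auto
  also have "run (?k # y # zig ys) [a] = run (zig ys) ([y] @ [?k, a])"
    using assms(2) by (simp add: run_push)
  also have "\<dots> = [y] @ zig (ys @ [a])" using assms by (intro run_zig) auto
  finally show ?thesis by simp
qed

text \<open>The word \<open>l\<close> of large entries encodes the settled permutation;
  \<open>c\<close> is 1 or 2 by the parity of the length. For \<open>c = 2\<close> the second entry
  is the \<open>A\<close> of \<open>run_zig_Cons\<close>.\<close>

lemma srt_rotate:
  assumes "c \<in> {1, 2}" "c \<le> length l" "\<forall>x\<in>set l. length l - c < x"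
  shows "srt (take c l @ zig (drop c l)) = take c (rotate1 l) @ zig (drop c (rotate1 l))"
proof (cases "c = 1")
  case True
  then obtain a l' where l: "l = a # l'" using assms(2) by (cases l) auto
  then show ?thesis
    using True assms(3) run_zig_Cons[of "[]"] by (cases l') (auto simp: srt_Cons)
next
  case False
  then have c: "c = 2" using assms(1) by simp
  then obtain a b l' where l: "l = a # b # l'" using assms(2)
    by (cases l; cases "tl l") auto
  have "run (b # w) [a] = run w ([b] @ [a])" for w by (simp add: run_push)
  then show ?thesis
    using c l assms(3) run_zig_Cons[of "[b]"] by (cases l') (auto simp: srt_Cons)
qed

lemma periodic_settled:
  assumes p: "distinct p" "set p = {1..n}" and n: "n = 2 * m + c" "c \<in> {1, 2}"
    and settled: "\<forall>e. 1 \<le> e \<and> e \<le> m \<longrightarrow> rpos p e = 2 * e - 1"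
  shows "\<exists>k>0. (srt ^^ k) p = p"
proof -
  have len: "length p = n" using p distinct_card by fastforce
  obtain W ys where W: "p = W @ zig ys" "length ys = m"
    using settled_imp_zig[of p m] p n len settled by auto
  define l where "l = W @ ys"
  have lW: "length W = c" using W len n by simp
  have p_eq: "p = take c l @ zig (drop c l)" using W lW by (simp add: l_def)
  have "mset p = mset (l @ [1..<Suc m])" using W by (simp add: mset_zig l_def)
  then have "distinct (l @ [1..<Suc m])" "set (l @ [1..<Suc m]) = {1..n}"
    using p mset_eq_imp_distinct_iff mset_eq_setD by blast+
  then have big: "\<forall>x\<in>set l. m < x" by (fastforce simp: not_le)
  have "(srt ^^ k) p = take c (rotate k l) @ zig (drop c (rotate k l))" for k
  proof (induction k)
    case (Suc k)
    have "length (rotate k l) = m + c" using W lW by (simp add: l_def)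
    then show ?case using Suc srt_rotate[OF n(2), of "rotate k l"] big by simp
  qed (simp add: p_eq)
  from this[of "length l"] have "(srt ^^ length l) p = p" using p_eq by simp
  moreover have "length l > 0" using lW n by (auto simp: l_def)
  ultimately show ?thesis by blast
qed

section \<open>Sharpness: a permutation that settles late\<close>

text \<open>Each entry of \<open>E\<close> finds two larger ones below it, pops the upper one and
  takes its place above \<open>a\<close>.\<close>

lemma run_decreasing:
  assumes "sorted_wrt (>) (a # x # E)"
  shows "run (E @ w) [x, a] = butlast (x # E) @ run w [last (x # E), a]"
  using assms
proof (induction E arbitrary: x)
  case (Cons y E)
  then have "run ((y # E) @ w) [x, a] = x # run (E @ w) [y, a]" by (simp add: run_push)
  with Cons show ?case by simp
qed simp

text \<open>The entry \<open>Suc (length ys)\<close> stays above \<open>a\<close> while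
  \<open>U\<close> passes, then opens the new zigzag, whose last partner is \<open>a\<close>. The
  order within \<open>U\<close> is lost, so only its multiset is tracked.\<close>

lemma srt_decreasing_zig:
  assumes "sorted_wrt (>) (a # E @ [Suc (length ys)])"
    "\<forall>x\<in>set U. Suc (length ys) < x" "\<forall>y\<in>set ys. length ys < y"
  shows "\<exists>V. mset V = mset U
     \<and> srt (a # E @ Suc (length ys) # U @ zig ys) = E @ V @ zig (ys @ [a])"
proof -
  let ?e = "Suc (length ys)"
  have 1: "run (E @ ?e # w) [a] = E @ run w [?e, a]" for w
  proof (cases E)
    case (Cons x E')
    then show ?thesis using run_decreasing[of a x "E' @ [?e]" w] assms(1) by (simp add: run_push)
  qed (simp add: run_push)
  have "\<forall>x\<in>set U. length (filter ((<) x) [?e, a]) \<le> 1" using assms(2) by fastforce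
  then obtain V A where VA: "\<forall>w. run (U @ w) ([] @ [?e, a]) = V @ run w (A @ [?e, a])"
    "mset V + mset A = mset [] + mset U" using run_protected by blast
  have "mset (V @ A) = mset U" using VA(2) by simp
  then have sA: "set (V @ A) = set U" by (metis mset_eq_setD)
  then have "\<forall>x\<in>set A. length ys < x" using assms(2) by (metis Suc_lessD UnCI set_append)
  moreover have "length ys < a" using assms(1) by simp
  ultimately have "run (zig ys) (A @ [?e, a]) = A @ zig (ys @ [a])"
    using assms(3) by (intro run_zig) auto
  then show ?thesis using 1 VA \<open>mset (V @ A) = mset U\<close>
    by (intro exI[of _ "V @ A"]) (simp add: srt_Cons)
qed

text \<open>Each step moves the head of \<open>D\<close> to the end of the partner queue and absorbs
  one more small value, until \<open>m\<close> is first.\<close>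

lemma funpow_srt_decreasing:
  assumes "sorted_wrt (>) (D @ rev [Suc (length ys)..<Suc m])" "Suc (length D + length ys) = m"
    "\<forall>x\<in>set U. m < x" "\<forall>y\<in>set ys. m < y" "\<forall>x\<in>set D. m < x"
  shows "\<exists>V. mset V = mset U
     \<and> (srt ^^ length D) (D @ rev [Suc (length ys)..<Suc m] @ U @ zig ys) = m # V @ zig (ys @ D)"
  using assms
proof (induction D arbitrary: ys U)
  case Nil
  then show ?case by (intro exI[of _ U]) auto
next
  case (Cons a D)
  define k where "k = Suc (length ys)"
  have k: "rev [k..<Suc m] = rev [Suc k..<Suc m] @ [k]"
    using Cons.prems(2) unfolding k_def by (subst upt_conv_Cons) auto
  have srt: "sorted_wrt (>) (a # (D @ rev [Suc k..<Suc m]) @ [k])"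
    using Cons.prems(1) unfolding k_def[symmetric] k by simp
  have k_le: "\<forall>x\<in>set U. k < x" and ys: "\<forall>y\<in>set ys. length ys < y"
    using Cons.prems(2-4) by (auto simp: k_def)
  obtain V where V: "mset V = mset U"
    "srt (a # (D @ rev [Suc k..<Suc m]) @ k # U @ zig ys) = (D @ rev [Suc k..<Suc m]) @ V @ zig (ys @ [a])"
    using srt_decreasing_zig[of a "D @ rev [Suc k..<Suc m]" ys U] srt k_le ys
    unfolding k_def[symmetric] by auto
  have sV: "set V = set U" using V(1) by (metis mset_eq_setD)
  have l: "Suc (length (ys @ [a])) = Suc k" by (simp add: k_def)
  obtain V' where V': "mset V' = mset V"
    "(srt ^^ length D) (D @ rev [Suc k..<Suc m] @ V @ zig (ys @ [a])) = m # V' @ zig ((ys @ [a]) @ D)"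
    using Cons.IH[of "ys @ [a]" V, unfolded l] srt Cons.prems(2-5) sV
    by (auto simp: sorted_wrt_append simp del: upt_Suc)
  have "(srt ^^ length (a # D)) ((a # D) @ rev [k..<Suc m] @ U @ zig ys)
      = (srt ^^ length D) (srt (a # (D @ rev [Suc k..<Suc m]) @ k # U @ zig ys))"
    unfolding k by (simp add: funpow_swap1)
  then show ?case using V V' unfolding k_def[symmetric] by (intro exI[of _ V']) simp
qed

lemma srt_zig:
  assumes "\<forall>x\<in>set (a # U @ y # ys). length (y # ys) < x"
  shows "\<exists>V. mset V = mset U \<and> srt (a # U @ zig (y # ys)) = V @ y # zig (ys @ [a])"
proof -
  have "\<forall>x\<in>set U. length (filter ((<) x) [a]) \<le> 1" by simp
  then obtain V A where VA: "\<forall>w. run (U @ w) ([] @ [a]) = V @ run w (A @ [a])"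
    "mset V + mset A = mset [] + mset U" using run_protected by blast
  have m: "mset (V @ A) = mset U" using VA(2) by simp
  then have sA: "set (V @ A) = set U" by (metis mset_eq_setD)
  have "run (zig (y # ys)) (A @ [a]) = A @ y # zig (ys @ [a])"
    using assms sA by (intro run_zig_Cons) auto
  then show ?thesis using VA(1) m by (intro exI[of _ "V @ A"]) (simp add: srt_Cons)
qed

text \<open>One partner leaves the queue per step, so \<open>ys ! i\<close> has just left after
  \<open>Suc i\<close> steps. Nonempty \<open>U\<close> provides a first entry for the next step,
  while the departed partner joins the middle part.\<close>

lemma funpow_srt_zig:
  assumes "\<forall>x\<in>set (a # U @ ys). length ys < x" "U \<noteq> []" "i < length ys"
  shows "\<exists>W ys'. (srt ^^ Suc i) (a # U @ zig ys) = W @ ys ! i # zig ys' \<and> length ys' = length ys"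
  using assms
proof (induction i arbitrary: a U ys)
  case 0
  then obtain y zs where ys: "ys = y # zs" by (cases ys) auto
  then show ?case using srt_zig[of a U y zs] 0 by (force intro: exI[of _ "zs @ [a]"])
next
  case (Suc i)
  then obtain y zs where ys: "ys = y # zs" by (cases ys) auto
  obtain V where V: "mset V = mset U" "srt (a # U @ zig (y # zs)) = V @ y # zig (zs @ [a])"
    using srt_zig[of a U y zs] Suc.prems ys by auto
  have sV: "set V = set U" using V(1) by (metis mset_eq_setD)
  then obtain v V' where vV: "V = v # V'" using Suc.prems(2) by (cases V) auto
  obtain W ys' where "(srt ^^ Suc i) (v # (V' @ [y]) @ zig (zs @ [a])) = W @ (zs @ [a]) ! i # zig ys'"
      "length ys' = length (zs @ [a])"
    using Suc.IH[of v "V' @ [y]" "zs @ [a]"] Suc.prems ys sV vV by auto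
  moreover have "(srt ^^ Suc (Suc i)) (a # U @ zig ys) = (srt ^^ Suc i) (srt (a # U @ zig ys))"
    by (simp add: funpow_swap1)
  ultimately show ?case using V(2) vV ys Suc.prems(3) by (auto simp: nth_append)
qed

text \<open>One step puts \<open>m\<close> at the end of a queue of \<open>m - 1\<close> partners;
  \<open>m - 1\<close> further steps bring it out directly before the zigzag.\<close>

lemma funpow_srt_head:
  assumes "\<forall>x\<in>set (U @ ys). m < x" "U \<noteq> []" "Suc (length ys) = m"
  shows "\<exists>W ys'. (srt ^^ m) (m # U @ zig ys) = W @ m # zig ys' \<and> length ys' = length ys"
proof (cases ys)
  case Nil
  then show ?thesis using srt_last[of m U] assms(3) by auto
next
  case (Cons y zs)
  have m: "m = Suc (Suc (length zs))" using assms(3) Cons by simp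
  then have lm: "length (y # zs) < m" by simp
  then have big: "\<forall>x\<in>set (m # U @ y # zs). length (y # zs) < x"
    using assms(1) Cons by (auto simp del: list.size intro: less_trans[OF lm])
  then obtain V where V: "mset V = mset U" "srt (m # U @ zig (y # zs)) = V @ y # zig (zs @ [m])"
    using srt_zig[OF big] by blast
  have sV: "set V = set U" using V(1) by (metis mset_eq_setD)
  then obtain v V' where vV: "V = v # V'" using assms(2) by (cases V) auto
  then have sU: "set U = insert v (set V')" using sV by simp
  have "\<exists>W ys'. (srt ^^ Suc (length zs)) (v # (V' @ [y]) @ zig (zs @ [m]))
      = W @ (zs @ [m]) ! length zs # zig ys' \<and> length ys' = length (zs @ [m])"
    using big unfolding sU set_append list.set by (intro funpow_srt_zig) auto
  moreover have "(srt ^^ m) (m # U @ zig ys) = (srt ^^ Suc (length zs)) (srt (m # U @ zig ys))"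
    by (simp only: m funpow_Suc_right comp_apply)
  ultimately show ?thesis using V(2) vV Cons by auto
qed

lemma unsettled_witness:
  assumes "1 \<le> m" "2 * m < n"
  shows "\<exists>p. distinct p \<and> set p = {1..n} \<and> rpos ((srt ^^ (2 * m - 1)) p) m \<noteq> 2 * m - 1"
proof -
  define D where "D = rev [n - m + 2..<Suc n]"
  define U where "U = [Suc m..<n - m + 2]"
  define p where "p = D @ rev [1..<Suc m] @ U"
  have lD: "Suc (length D) = m" using assms by (simp add: D_def del: upt_Suc)
  have "distinct p" using assms by (auto simp: p_def D_def U_def)
  have "set p = {1..n}" using assms by (auto simp: p_def D_def U_def)
  have DU: "\<forall>x\<in>set (U @ D). m < x" using assms by (auto simp: D_def U_def)
  have "sorted_wrt (>) (D @ rev [Suc (length [])..<Suc m])" using assms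
    by (auto simp: D_def sorted_wrt_append sorted_wrt_rev simp del: upt_Suc)
  then obtain V where V: "mset V = mset U" "(srt ^^ length D) p = m # V @ zig D"
    using funpow_srt_decreasing[of D "[]" m U] lD DU by (auto simp: p_def)
  have sV: "set V = set U" using V(1) by (metis mset_eq_setD)
  have "U \<noteq> []" using assms by (simp add: U_def)
  then have "V \<noteq> []" using sV by auto
  then obtain W ys where W: "(srt ^^ m) (m # V @ zig D) = W @ m # zig ys" "length ys = length D"
    using funpow_srt_head[of V D m] lD DU sV by auto
  have "2 * m - 1 = m + length D" using lD by simp
  then have q: "(srt ^^ (2 * m - 1)) p = W @ m # zig ys" using V(2) W(1) by (simp add: funpow_add)
  have "distinct (W @ m # zig ys)" using \<open>distinct p\<close> by (simp flip: q)
  \<comment> \<open>The zigzag has \<open>m - 1\<close> pairs, so the distance is even and one short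
    of the settled \<open>2 * m - 1\<close>.\<close>
  then have "rpos ((srt ^^ (2 * m - 1)) p) m = 2 * length D" unfolding q
    using rpos_append[of m "zig ys" W] W(2) by simp
  then have "rpos ((srt ^^ (2 * m - 1)) p) m \<noteq> 2 * m - 1" using lD by simp
  with \<open>distinct p\<close> \<open>set p = {1..n}\<close> show ?thesis by blast
qed

section \<open>Periodicity along orbits and the value of the order\<close>

lemma periodic_under_funpow:
  assumes "periodic_under f x"
  shows "periodic_under f ((f ^^ j) x)"
proof -
  obtain k where k: "k > 0" "(f ^^ k) x = x" using assms by (auto simp: periodic_under_def)
  have "(f ^^ k) ((f ^^ j) x) = (f ^^ j) ((f ^^ k) x)"
    by (metis add.commute comp_apply funpow_add)
  with k show ?thesis by (auto simp: periodic_under_def)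
qed

theorem theorem1p2:
  fixes n :: nat
  assumes "n \<ge> 1"
  shows "ord_under (stack_map [1, 2, 3] [1, 3, 2]) (permutations_of_set {1..n})
    = 2 * ((n - 1) div 2)"
proof -
  let ?f = "stack_map [1, 2, 3] [1, 3, 2]"
  let ?S = "permutations_of_set {1..n}"
  define m where "m = (n - 1) div 2"
  define c where "c = n - 2 * m"
  have n: "n = 2 * m + c" "c \<in> {1, 2}" "2 * m < n" using assms by (auto simp: m_def c_def)
  have S: "p \<in> ?S \<longleftrightarrow> distinct p \<and> set p = {1..n}" for p
    by (auto simp: permutations_of_set_def)
  have f_srt: "(?f ^^ k) p = (srt ^^ k) p" if "p \<in> ?S" for p k
  proof (induction k)
    case (Suc k)
    have "distinct ((srt ^^ k) p)" using that S by simp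
    from Suc stack_map_eq_srt[OF this] show ?case by simp
  qed simp
  have fixed: "(g ^^ i) q = q" if "g q = q" for g :: "nat list \<Rightarrow> nat list" and q i
    using that by (induction i) auto
  have in_S: "(srt ^^ k) p \<in> ?S" if "p \<in> ?S" for p k using that S by simp
  have "(LEAST k. \<forall>x\<in>(?f ^^ k) ` ?S. periodic_under ?f x) = 2 * m"
  proof (rule Least_equality)
    show "\<forall>x\<in>(?f ^^ (2 * m)) ` ?S. periodic_under ?f x"
    proof clarify
      fix p assume p: "p \<in> ?S"
      let ?q = "(srt ^^ (2 * m)) p"
      have "\<exists>k>0. (srt ^^ k) ?q = ?q"
      proof (rule periodic_settled[OF _ _ n(1,2)])
        show "\<forall>e. 1 \<le> e \<and> e \<le> m \<longrightarrow> rpos ?q e = 2 * e - 1"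
          using p S rpos_settled[OF _ _ n(3), of p "2 * m"] by simp
      qed (use p S in simp_all)
      then show "periodic_under ?f ((?f ^^ (2 * m)) p)"
        unfolding periodic_under_def f_srt[OF p] f_srt[OF in_S[OF p]] .
    qed
  next
    fix k assume k: "\<forall>x\<in>(?f ^^ k) ` ?S. periodic_under ?f x"
    show "2 * m \<le> k"
    proof (rule ccontr)
      assume "\<not> 2 * m \<le> k"
      then have km: "k \<le> 2 * m - 1" "1 \<le> m" by auto
      obtain p where "distinct p" "set p = {1..n}"
        and un: "rpos ((srt ^^ (2 * m - 1)) p) m \<noteq> 2 * m - 1"
        using unsettled_witness[OF km(2) n(3)] by blast
      then have p: "p \<in> ?S" using S by simp
      let ?q = "(srt ^^ (2 * m - 1)) p"
      have "periodic_under ?f ((?f ^^ k) p)" using k p by blast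
      \<comment> \<open>Periodicity passes forward along the orbit, so time \<open>k\<close> may be
        advanced to \<open>2 * m - 1\<close>, where the witness is unsettled.\<close>
      then have "periodic_under ?f ((?f ^^ (2 * m - 1 - k)) ((?f ^^ k) p))"
        by (rule periodic_under_funpow)
      moreover have "(?f ^^ (2 * m - 1 - k)) ((?f ^^ k) p) = (?f ^^ (2 * m - 1)) p"
        using km(1) by (metis comp_apply funpow_add le_add_diff_inverse2)
      ultimately obtain j where j: "j > 0" "(srt ^^ j) ?q = ?q"
        unfolding periodic_under_def using f_srt in_S p by metis
      \<comment> \<open>Repeating the period \<open>2 * m\<close> times gives at least
        \<open>2 * m\<close> steps, after which \<open>m\<close> must be settled, although
        \<open>?q\<close> is unchanged.\<close>
      then have "((srt ^^ j) ^^ (2 * m)) ?q = ?q"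
        using fixed[of "srt ^^ j" ?q] by simp
      then have fix_q: "(srt ^^ (j * (2 * m))) ?q = ?q" by (simp only: funpow_mult)
      have "rpos ((srt ^^ (j * (2 * m))) ?q) m = 2 * m - 1"
        using rpos_settled[OF _ _ n(3), of ?q "j * (2 * m)" m] in_S[OF p] S j(1) km(2) by simp
      with fix_q un show False by simp
    qed
  qed
  then show ?thesis unfolding ord_under_def m_def .
qed

end
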